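(* Let $d \geq 1$, $1 \leq p < \infty$ and $s > d / p$. A QMC-design sequence $(X_N)$ for $\mathbb{W}_p^s(\mathbb{S}^d)$ is also a QMC-design sequence for $\mathbb{W}_{p'}^s(\mathbb{S}^d)$ for all $p'$ satisfying $p < p' \leq \infty$.
   Context: $\mathbb{S}^d$ is the unit sphere in $\mathbb{R}^{d+1}$, $\sigma_d$ its normalized surface area measure, and $\mathbb{L}_p(\mathbb{S}^d)$ the real $L_p$ space with respect to $\sigma_d$, with norm $\|\cdot\|_p$. Convention: $1/\infty = 0$. Sobolev space: for $f \in \mathbb{L}_1(\mathbb{S}^d)$ let $Y_\ell[f]$ be the projection of $f$ onto the spherical harmonics of exact degree $\ell$ on $\mathbb{S}^d$ (defined by integrating $f$ against the zonal reproducing kernel of that space), and let $\lambda_\ell = \ell(\ell+d-1)$ be the corresponding eigenvalue of the negative Laplace–Beltrami operator $-\Delta_d^*$. For $s \geq 0$, $1 \leq p \leq \infty$, $\mathbb{W}_p^s(\mathbb{S}^d)$ is the set of $f \in \mathbb{L}_p(\mathbb{S}^d)$ for which $(1-\Delta_d^* )^{s/2} f = \sum_{\ell\ge 0} (1+\lambda_\ell)^{s/2} Y_\ell[f]$ is in $\mathbb{L}_p(\mathbb{S}^d)$ (i.e. there is $g\in \mathbb{L}_p(\mathbb{S}^d)$ with $Y_\ell[g] = (1+\lambda_\ell)^{s/2} Y_\ell[f]$ for all $\ell$), with norm $\|f\|_{\mathbb{W}_p^s(\mathbb{S}^d)} = \|(1-\Delta_d^* )^{s/2} f\|_p$. For $s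 > d/p$ this space embeds continuously into $C(\mathbb{S}^d)$, and its elements are identified with their continuous representatives. Worst-case error: for $X_N = \{\mathbf{x}_1,\dots,\mathbf{x}_N\}\subset \mathbb{S}^d$, $Q[X_N](f) = \frac1N \sum_{k=1}^N f(\mathbf{x}_k)$, $I(f) = \int_{\mathbb{S}^d} f\, d\sigma_d$, and for $s>d/p$ $$\operatorname{wce}(Q[X_N]; \mathbb{W}_p^s(\mathbb{S}^d)) = \sup\{ |Q[X_N](f) - I(f)| : f \in \mathbb{W}_p^s(\mathbb{S}^d),\ \|f\|_{\mathbb{W}_p^s(\mathbb{S}^d)} \leq 1\}.$$ QMC-design sequence: given $s > d/p$, a sequence $(X_N)$ of $N$-point configurations on $\mathbb{S}^d$, with $N\to\infty$ ($N$ running through some infinite subset of the natural numbers), is a QMC-design sequence for $\mathbb{W}_p^s(\mathbb{S}^d)$ if there is a constant $c_{p,s,d}>0$, independent of $N$, such that $\operatorname{wce}(Q[X_N];\mathbb{W}_p^s(\mathbb{S}^d)) \leq c_{p,s,d}\, N^{-s/d}$ for all $X_N$ in the sequence. *)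

theory Defs
  imports "HOL-Analysis.Analysis" "HOL-Probability.Essential_Supremum"
begin

text \<open>Throughout, the sphere \<open>S\<^sup>d\<close> is \<open>sphere 0 1\<close> in a Euclidean space \<open>'a\<close>
  with \<open>DIM('a) = d + 1\<close>, so \<open>d = DIM('a) - 1\<close>.\<close>

section \<open>Surface measure and \<open>L\<^sub>p\<close> spaces\<close>

text \<open>Normalized surface measure in polar-coordinate form: \<open>\<sigma>(A)\<close> is the Lebesgue measure
  of the cone \<open>{r x | 0 < r < 1, x \<in> A}\<close> divided by that of the unit ball;
  \<open>sgn x = x / norm x\<close> is the radial projection. Since \<open>sgn 0 = 0\<close>, the image measure
  is taken on the whole space and then restricted.\<close>

definition sphere_measure :: "'a::euclidean_space measure" where
  "sphere_measure =
     restrict_space (distr (uniform_measure lborel (ball 0 1)) borel sgn) (sphere 0 1)"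

definition lp_norm :: "'a measure \<Rightarrow> ereal \<Rightarrow> ('a \<Rightarrow> real) \<Rightarrow> ennreal" where
  "lp_norm M p f =
     (if p = \<infinity> then esssup M (\<lambda>x. ennreal \<bar>f x\<bar>)
      else (let r = real_of_ereal p; J = (\<integral>\<^sup>+x. ennreal (\<bar>f x\<bar> powr r) \<partial>M)
            in if J = \<infinity> then \<infinity> else ennreal (enn2real J powr (1 / r))))"

definition lp_space :: "'a measure \<Rightarrow> ereal \<Rightarrow> ('a \<Rightarrow> real) set" where
  "lp_space M p = {f \<in> borel_measurable M. lp_norm M p f < \<infinity>}"

section \<open>Spherical harmonics\<close>

definition laplacian :: "('a::euclidean_space \<Rightarrow> real) \<Rightarrow> 'a \<Rightarrow> real" where
  "laplacian p x = (\<Sum>b\<in>Basis. (deriv ^^ 2) (\<lambda>t. p (x + t *\<^sub>R b)) 0)"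

text \<open>Restrictions to the sphere of homogeneous harmonic polynomials of degree \<open>l\<close>
  (including 0, so that this is a vector space). They are made extensional off the sphere,
  so that equality is equality on the sphere.\<close>

definition spherical_harmonics :: "nat \<Rightarrow> ('a::euclidean_space \<Rightarrow> real) set" where
  "spherical_harmonics l =
     {restrict p (sphere 0 1) | p.
        real_polynomial_function p \<and>
        (\<forall>c x. p (c *\<^sub>R x) = c ^ l * p x) \<and>
        (\<forall>x. laplacian p x = 0)}"

text \<open>The reproducing kernel of \<open>spherical_harmonics l\<close> with respect to the \<open>L\<^sub>2\<close> inner
  product. It exists and is unique, the space being finite-dimensional. By rotation
  invariance \<open>zonal_kernel l x y\<close> depends on \<open>x \<bullet> y\<close> only.\<close>

definition zonal_kernel :: "nat \<Rightarrow> 'a::euclidean_space \<Rightarrow> 'a \<Rightarrow> real" where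
  "zonal_kernel l x =
     (THE k. k \<in> spherical_harmonics l \<and>
             (\<forall>h\<in>spherical_harmonics l. h x = (\<integral>y. k y * h y \<partial>sphere_measure)))"

definition harmonic_proj :: "nat \<Rightarrow> ('a::euclidean_space \<Rightarrow> real) \<Rightarrow> 'a \<Rightarrow> real" where
  "harmonic_proj l f x = (\<integral>y. f y * zonal_kernel l x y \<partial>sphere_measure)"

definition laplace_eigenvalue :: "nat \<Rightarrow> nat \<Rightarrow> real" where
  "laplace_eigenvalue d l = real l * (real l + real d - 1)"

section \<open>Sobolev spaces\<close>

text \<open>\<open>is_bessel_deriv s f g\<close> says that \<open>g\<close> is the function with the Laplace series of
  \<open>(1 - \<Delta>\<^sup>*)\<^bsup>s/2\<^esup> f\<close>. Such a \<open>g\<close> in \<open>L\<^sub>1\<close> is unique up to null sets, hence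
  neither \<open>bessel_deriv\<close> nor the norm below depends on the choice made (up to null sets).\<close>

definition is_bessel_deriv ::
  "real \<Rightarrow> ('a::euclidean_space \<Rightarrow> real) \<Rightarrow> ('a \<Rightarrow> real) \<Rightarrow> bool" where
  "is_bessel_deriv s f g \<longleftrightarrow>
     g \<in> lp_space sphere_measure 1 \<and>
     (\<forall>l. \<forall>x\<in>sphere 0 1. harmonic_proj l g x =
        (1 + laplace_eigenvalue (DIM('a) - 1) l) powr (s / 2) * harmonic_proj l f x)"

definition bessel_deriv :: "real \<Rightarrow> ('a::euclidean_space \<Rightarrow> real) \<Rightarrow> 'a \<Rightarrow> real" where
  "bessel_deriv s f = (SOME g. is_bessel_deriv s f g)"

definition sobolev_space :: "ereal \<Rightarrow> real \<Rightarrow> ('a::euclidean_space \<Rightarrow> real) set" where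
  "sobolev_space p s =
     {f \<in> lp_space sphere_measure p. \<exists>g\<in>lp_space sphere_measure p. is_bessel_deriv s f g}"

definition sobolev_norm :: "ereal \<Rightarrow> real \<Rightarrow> ('a::euclidean_space \<Rightarrow> real) \<Rightarrow> ennreal" where
  "sobolev_norm p s f = lp_norm sphere_measure p (bessel_deriv s f)"

section \<open>Worst-case error and QMC designs\<close>

definition qmc_rule :: "nat \<Rightarrow> (nat \<Rightarrow> 'a) \<Rightarrow> ('a \<Rightarrow> real) \<Rightarrow> real" where
  "qmc_rule N x f = (1 / real N) * (\<Sum>k=1..N. f (x k))"

text \<open>Elements of the Sobolev space are identified with their continuous representatives,
  so the supremum is over the continuous functions in the space. It is taken in
  \<open>ennreal\<close> and therefore meaningful without a boundedness proof.\<close>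

definition wce :: "ereal \<Rightarrow> real \<Rightarrow> nat \<Rightarrow> (nat \<Rightarrow> 'a::euclidean_space) \<Rightarrow> ennreal" where
  "wce p s N x =
     (SUP f \<in> {f \<in> sobolev_space p s. continuous_on (sphere 0 1) f \<and> sobolev_norm p s f \<le> 1}.
        ennreal \<bar>qmc_rule N x f - (\<integral>y. f y \<partial>sphere_measure)\<bar>)"

text \<open>\<open>X N 1, \<dots>, X N N\<close> are the points of the configuration \<open>X\<^sub>N\<close>, and \<open>N\<close> runs through
  the index set \<open>I\<close>. Repeated points are allowed.\<close>

definition qmc_design_sequence ::
  "ereal \<Rightarrow> real \<Rightarrow> nat set \<Rightarrow> (nat \<Rightarrow> nat \<Rightarrow> 'a::euclidean_space) \<Rightarrow> bool" where
  "qmc_design_sequence p s I X \<longleftrightarrow>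
     infinite I \<and> 0 \<notin> I \<and>
     (\<forall>N\<in>I. \<forall>k\<in>{1..N}. X N k \<in> sphere 0 1) \<and>
     (\<exists>c>0. \<forall>N\<in>I. wce p s N (X N) \<le> ennreal (c * real N powr (- s / real (DIM('a) - 1))))"

end

theory Submission
  imports Defs "HOL-Probability.Probability_Measure"
begin

text \<open>The worst-case error is a supremum over the continuous functions in the unit ball of the
  Sobolev space, so it suffices that these unit balls shrink as the integrability exponent grows.
  The function \<open>(1 - \<Delta>\<^sup>*)\<^bsup>s/2\<^esup> f\<close> is determined by the Laplace coefficients of \<open>f\<close> and
  does not depend on the exponent; hence the inclusion of the balls is nothing but the
  inequality \<open>\<parallel>g\<parallel>\<^sub>p \<le> \<parallel>g\<parallel>\<^sub>q\<close> for \<open>p \<le> q\<close>, which holds with constant 1 because \<open>\<sigma>\<^sub>d\<close> is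
  normalized (\<open>lp_norm_mono_exponent\<close>). Consequently the worst-case error is antitone in the
  exponent (\<open>wce_antimono_exponent\<close>), and since the rate \<open>N\<^bsup>-s/d\<^esup>\<close> is the same for every
  exponent, a bound for one exponent holds with the same constant for all larger ones.\<close>

text \<open>The radial projection of the uniform distribution on the ball is a probability measure,
  and restriction to the sphere cannot increase the mass.\<close>

lemma emeasure_sphere_measure_le_1:
  "emeasure (sphere_measure :: 'a::euclidean_space measure) (space sphere_measure) \<le> 1"
proof -
  let ?U = "uniform_measure lborel (ball (0::'a) 1)"
  have "emeasure lborel (ball (0::'a) 1) \<noteq> 0"
    by (simp add: emeasure_ball unit_ball_vol_pos[THEN less_imp_neq, symmetric])
  moreover have "emeasure lborel (ball (0::'a) 1) \<noteq> \<infinity>"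
    using emeasure_lborel_ball_finite[of "0::'a" 1] by auto
  ultimately interpret U: prob_space ?U
    by (rule prob_space_uniform_measure)
  have "sgn \<in> measurable ?U (borel :: 'a measure)"
    unfolding sgn_div_norm[abs_def] by measurable
  then interpret D: prob_space "distr ?U borel sgn"
    by (rule U.prob_space_distr)
  show ?thesis
    unfolding sphere_measure_def
    by (simp add: emeasure_restrict_space space_restrict_space D.emeasure_le_1)
qed

lemma lp_norm_le_if_nn_integral_le:
  assumes "0 < r" "0 < a"
    and J: "(\<integral>\<^sup>+x. ennreal (\<bar>f x\<bar> powr r) \<partial>M) \<le> ennreal (a powr r)"
  shows "lp_norm M (ereal r) f \<le> ennreal a"
proof -
  let ?J = "\<integral>\<^sup>+x. ennreal (\<bar>f x\<bar> powr r) \<partial>M"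
  have fin: "?J \<noteq> \<infinity>"
    using J by (auto simp: top_unique)
  have "enn2real ?J \<le> a powr r"
    using J by (simp add: enn2real_leI)
  then have "enn2real ?J powr (1 / r) \<le> (a powr r) powr (1 / r)"
    using assms by (intro powr_mono2) auto
  also have "\<dots> = a"
    using assms by (simp add: powr_powr)
  finally show ?thesis
    using fin by (simp add: lp_norm_def Let_def ennreal_leI)
qed

lemma nn_integral_le_if_lp_norm_less:
  assumes "0 < q" "0 < a" and "lp_norm M (ereal q) f < ennreal a"
  shows "(\<integral>\<^sup>+x. ennreal (\<bar>f x\<bar> powr q) \<partial>M) \<le> ennreal (a powr q)"
proof -
  let ?J = "\<integral>\<^sup>+x. ennreal (\<bar>f x\<bar> powr q) \<partial>M"
  have fin: "?J \<noteq> \<infinity>"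
    using assms by (auto simp: lp_norm_def Let_def)
  with assms have "enn2real ?J powr (1 / q) < a"
    by (auto simp: lp_norm_def Let_def ennreal_less_iff)
  then have "(enn2real ?J powr (1 / q)) powr q \<le> a powr q"
    using assms by (intro powr_mono2) auto
  then have "enn2real ?J \<le> a powr q"
    using assms by (simp add: powr_powr)
  then have "ennreal (enn2real ?J) \<le> ennreal (a powr q)"
    by (rule ennreal_leI)
  moreover have "ennreal (enn2real ?J) = ?J"
    using fin by (intro ennreal_enn2real) (simp add: less_top)
  ultimately show ?thesis
    by simp
qed

text \<open>Young's inequality, with 1 as the second factor: after integration over a measure of
  mass at most 1 it replaces Jensen's inequality.\<close>

lemma powr_le_convex_combination:
  fixes t r q :: real
  assumes "0 \<le> t" "0 < r" "r \<le> q"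
  shows "t powr r \<le> (1 - r / q) + r / q * t powr q"
proof -
  have "(t powr q) powr (r / q) * 1 powr (1 - r / q) \<le> r / q * t powr q + (1 - r / q) * 1"
    if "t \<noteq> 0"
    using assms that by (intro Youngs_inequality_0) auto
  then show ?thesis
    using assms by (cases "t = 0") (auto simp: powr_powr)
qed

text \<open>Comparing with an arbitrary real bound \<open>a > lp_norm M p' f\<close> makes it possible to divide by \<open>a\<close>
  even when the norm vanishes. It then suffices that \<open>\<bar>f\<bar> / a\<close> has \<open>p\<close>-th moment at most 1:
  the function \<open>\<bar>f\<bar> / a\<close> is at most 1 almost everywhere if \<open>p' = \<infinity>\<close>, and otherwise Young's inequality bounds
  its \<open>p\<close>-th moment by a convex combination of the mass and of its \<open>p'\<close>-th moment.\<close>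

lemma lp_norm_mono_exponent:
  fixes p p' :: ereal
  assumes f: "f \<in> borel_measurable M"
    and mass: "emeasure M (space M) \<le> 1"
    and "0 < p" "p \<le> p'"
  shows "lp_norm M p f \<le> lp_norm M p' f"
proof (cases "p = \<infinity>")
  case True
  then show ?thesis using assms by simp
next
  case False
  then obtain r where p: "p = ereal r" and r: "0 < r"
    using \<open>0 < p\<close> by (cases p) auto
  show ?thesis
  proof (rule dense_ge)
    fix b assume b: "lp_norm M p' f < b"
    show "lp_norm M p f \<le> b"
    proof (cases b)
      case top
      then show ?thesis by simp
    next
      case (real a)
      with b have a: "0 < a"
        by (cases "a = 0") auto
      have "(\<integral>\<^sup>+x. ennreal (\<bar>f x\<bar> powr r) \<partial>M) \<le> ennreal (a powr r)"
      proof (cases "p' = \<infinity>")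
        case True
        have "AE x in M. ennreal \<bar>f x\<bar> \<le> esssup M (\<lambda>x. ennreal \<bar>f x\<bar>)"
          by (rule esssup_AE)
        then have "AE x in M. ennreal (\<bar>f x\<bar> powr r) \<le> ennreal (a powr r)"
        proof eventually_elim
          case (elim x)
          also have "esssup M (\<lambda>x. ennreal \<bar>f x\<bar>) \<le> ennreal a"
            using b real True by (simp add: lp_norm_def)
          finally have "ennreal \<bar>f x\<bar> \<le> ennreal a" .
          then have "\<bar>f x\<bar> \<le> a"
            using a by (simp add: ennreal_le_iff)
          then show ?case
            using r by (intro ennreal_leI powr_mono2) auto
        qed
        then have "(\<integral>\<^sup>+x. ennreal (\<bar>f x\<bar> powr r) \<partial>M) \<le> (\<integral>\<^sup>+x. ennreal (a powr r) \<partial>M)"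
          by (rule nn_integral_mono_AE)
        also have "\<dots> \<le> ennreal (a powr r) * 1"
          using mass by (simp add: mult_left_mono del: mult_1_right)
        finally show ?thesis by simp
      next
        case False
        then obtain q where p': "p' = ereal q" and rq: "r \<le> q"
          using \<open>p \<le> p'\<close> p by (cases p') auto
        have q: "0 < q" "r / q \<le> 1"
          using r rq by auto
        define A where "A = a powr r * (1 - r / q)"
        define B where "B = a powr r * (r / q) / a powr q"
        have AB: "0 \<le> A" "0 \<le> B"
          using r q a by (auto simp: A_def B_def)
        have pointwise: "\<bar>f x\<bar> powr r \<le> A + B * \<bar>f x\<bar> powr q" for x
        proof -
          have "a powr r * (\<bar>f x\<bar> / a) powr r
              \<le> a powr r * ((1 - r / q) + r / q * (\<bar>f x\<bar> / a) powr q)"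
            using a r rq by (intro mult_left_mono powr_le_convex_combination) auto
          then show ?thesis
            using a by (simp add: A_def B_def powr_divide algebra_simps)
        qed
        have "(\<integral>\<^sup>+x. ennreal (\<bar>f x\<bar> powr r) \<partial>M)
            \<le> (\<integral>\<^sup>+x. ennreal A + ennreal B * ennreal (\<bar>f x\<bar> powr q) \<partial>M)"
          using pointwise AB
          by (intro nn_integral_mono)
             (simp flip: ennreal_mult ennreal_plus add: ennreal_leI)
        also have "\<dots> = ennreal A * emeasure M (space M)
            + ennreal B * (\<integral>\<^sup>+x. ennreal (\<bar>f x\<bar> powr q) \<partial>M)"
          using f by (simp add: nn_integral_add nn_integral_cmult)
        also have "\<dots> \<le> ennreal A * 1 + ennreal B * ennreal (a powr q)"
          using mass nn_integral_le_if_lp_norm_less[of q a M f] q a b real p'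
          by (intro add_mono mult_left_mono) auto
        also have "\<dots> = ennreal (A + B * a powr q)"
          using AB by (simp flip: ennreal_mult ennreal_plus)
        also have "A + B * a powr q = a powr r"
          using a by (simp add: A_def B_def algebra_simps)
        finally show ?thesis .
      qed
      with r a real show ?thesis
        by (simp add: p lp_norm_le_if_nn_integral_le)
    qed
  qed
qed

lemma lp_space_antimono_exponent:
  fixes p p' :: ereal
  assumes "emeasure M (space M) \<le> 1" "0 < p" "p \<le> p'"
  shows "lp_space M p' \<subseteq> lp_space M p"
  using lp_norm_mono_exponent[OF _ assms] by (auto simp: lp_space_def intro: le_less_trans)

lemma sobolev_space_antimono_exponent:
  fixes p p' :: ereal
  assumes "0 < p" "p \<le> p'"
  shows "sobolev_space p' s \<subseteq> sobolev_space p s"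
  using lp_space_antimono_exponent[OF emeasure_sphere_measure_le_1 assms]
  unfolding sobolev_space_def by blast

text \<open>Both norms are taken of one and the same function \<open>bessel_deriv s f\<close>. Membership of \<open>f\<close> in
  a Sobolev space makes this a genuine Bessel derivative, which gives its measurability.\<close>

lemma sobolev_norm_mono_exponent:
  fixes p p' :: ereal
  assumes "0 < p" "p \<le> p'" and "f \<in> sobolev_space p' s"
  shows "sobolev_norm p s f \<le> sobolev_norm p' s f"
proof -
  have "\<exists>g. is_bessel_deriv s f g"
    using assms(3) by (auto simp: sobolev_space_def)
  then have "is_bessel_deriv s f (bessel_deriv s f)"
    unfolding bessel_deriv_def by (rule someI_ex)
  then have "bessel_deriv s f \<in> borel_measurable sphere_measure"
    by (simp add: is_bessel_deriv_def lp_space_def)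
  then show ?thesis
    unfolding sobolev_norm_def
    using assms by (intro lp_norm_mono_exponent emeasure_sphere_measure_le_1)
qed

lemma wce_antimono_exponent:
  fixes p p' :: ereal
  assumes "0 < p" "p \<le> p'"
  shows "wce p' s N x \<le> wce p s N x"
  unfolding wce_def
proof (rule SUP_subset_mono)
  show "{f \<in> sobolev_space p' s. continuous_on (sphere 0 1) f \<and> sobolev_norm p' s f \<le> 1}
      \<subseteq> {f \<in> sobolev_space p s. continuous_on (sphere 0 1) f \<and> sobolev_norm p s f \<le> 1}"
    using sobolev_space_antimono_exponent[OF assms] sobolev_norm_mono_exponent[OF assms]
    by (blast intro: order_trans)
qed simp

theorem theorem1p10:
  fixes d :: nat and p p' :: ereal and s :: real
    and I :: "nat set" and X :: "nat \<Rightarrow> nat \<Rightarrow> 'a::euclidean_space"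
  assumes "d \<ge> 1" and "DIM('a) = d + 1"
    and "1 \<le> p" and "p < \<infinity>"
    and "ereal s > ereal (real d) / p"
    and "qmc_design_sequence p s I X"
    and "p < p'" and "p' \<le> \<infinity>"
  shows "qmc_design_sequence p' s I X"
proof -
  have "0 < p"
    using \<open>1 \<le> p\<close> by (rule less_le_trans[rotated]) simp
  then have "wce p' s N (X N) \<le> wce p s N (X N)" for N
    using \<open>p < p'\<close> by (intro wce_antimono_exponent) auto
  then show ?thesis
    using assms(6) unfolding qmc_design_sequence_def by (blast intro: order_trans)
qed

end
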